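(* Let $\vartheta\in[0,2]$. Let $K\in\mathcal{K}^+_{0,\vartheta}$ satisfy the following three conditions: $$\text{for all }y\in\mathbb{R}^n\text{ and all }x_0\in B_3\setminus\{y\},\quad\lim_{x\to x_0}K(x,y)=K(x_0,y);$$ $$\text{for all }x_0\in B_3\text{ and all }r>0,\quad\int_{\mathbb{R}^n\setminus B_r(x_0)}\ \sup_{x\in B_3\setminus B_r(y)}|K(x,y)|\,dy<+\infty;$$ $$\int_{B_3}\sup_{x\in B_1}|x-y|^2|K(x,y)|\,dy<+\infty.$$ Let $u\in\mathcal{V}_K$ and let $f$ be bounded and continuous in $B_1$. Then $$Au=f\quad\text{in }B_1\text{ in the viscosity sense}$$ is equivalent to $$Au\stackrel{0}{=}f\quad\text{in }B_1\text{ in the viscosity sense}.$$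
   Context: $B_r(x)$ is the open ball in $\mathbb{R}^n$ of radius $r$ centered at $x$, $B_r:=B_r(0)$, $\Omega^c:=\mathbb{R}^n\setminus\Omega$. All functions and kernels are real-valued and Lebesgue measurable. $\chi_R$ is the characteristic function of $B_R$. For a kernel $K=K(x,y)$ the operator $A$ is $$Au(x)=\lim_{\varepsilon\searrow0}\int_{\mathbb{R}^n\setminus B_\varepsilon(x)}(u(x)-u(y))K(x,y)\,dy.$$ $\mathcal{K}^+_{0,\vartheta}$ is the set of kernels $K$ such that: for all $y\in B_3^c$ the map $B_1\ni x\mapsto K(x,y)$ is continuous; $\int_{\mathbb{R}^n}\min\{|x-y|^\vartheta,1\}|K(x,y)|\,dy<+\infty$ for all $x\in B_1$; $K(x,x+z)=K(x,x-z)$ for all $x,z\in B_1$; and $K(x,y)\ge0$ for all $x\in B_1$, $y\in\mathbb{R}^n$. For $K\in\mathcal{K}^+_{0,\vartheta}$, $\mathcal{V}_K$ (with $m=0$) is the set of $u\in L^1_{\rm loc}(\mathbb{R}^n)\cap C(B_4)\cap L^\infty(B_4)$ such that $\int_{B_3^c}|u(y)|\sup_{x\in B_1}|K(x,y)|\,dy<+\infty$. $Av=g$ in $B_1$ in the viscosity sense means: whenever $x_0\in B_1$, $B_\rho(x_0)\Subset B_1$ and $\varphi:\mathbb{R}^n\to\mathbb{R}$ is $C^2$ on $\overline{B_\rho(x_0)}$, with $\varphi=v$ outside $B_\rho(x_0)$ and $\varphi(x_0)=v(x_0)$, one has $A\varphi(x_0)\ge g(x_0)$ if $\varphi\le v$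 in $B_\rho(x_0)$, and $A\varphi(x_0)\le g(x_0)$ if $\varphi\ge v$ in $B_\rho(x_0)$. $Au\stackrel{0}{=}f$ in $B_1$ in the viscosity sense means that there exist bounded continuous functions $f_R:B_1\to\mathbb{R}$ ($R>3$) such that $A(\chi_Ru)=f_R$ in $B_1$ in the viscosity sense and $f_R\to f$ uniformly in $B_1$ as $R\to+\infty$. (This is the case $m=0$ of the general definition, in which $A(\chi_Ru)=f_R+P_R$ with $P_R$ a polynomial of degree at most $m-1$.) *)

theory Defs
  imports "HOL-Analysis.Analysis"
begin

text \<open>
  An integral over \<open>S\<close> is called finite only if the integrand is Lebesgue measurable on \<open>S\<close>; for a
  non-measurable integrand, \<open>nn_integral\<close> would only be a lower integral. Integrands are
  \<open>ennreal\<close>-valued, so a pointwise supremum may be infinite and \<open>0 * \<infinity> = 0\<close>.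
\<close>

definition finite_lebesgue_integral :: "(real^'n) set \<Rightarrow> (real^'n \<Rightarrow> ennreal) \<Rightarrow> bool" where
  "finite_lebesgue_integral S g \<longleftrightarrow>
     (\<lambda>y. g y * indicator S y) \<in> borel_measurable lebesgue \<and>
     (\<integral>\<^sup>+y\<in>S. g y \<partial>lebesgue) < \<infinity>"

definition truncated_integral ::
  "(real^'n \<Rightarrow> real^'n \<Rightarrow> real) \<Rightarrow> (real^'n \<Rightarrow> real) \<Rightarrow> real^'n \<Rightarrow> real \<Rightarrow> real" where
  "truncated_integral K u x \<epsilon> = (LINT y:- ball x \<epsilon>|lebesgue. (u x - u y) * K x y)"

definition nonlocal_op ::
  "(real^'n \<Rightarrow> real^'n \<Rightarrow> real) \<Rightarrow> (real^'n \<Rightarrow> real) \<Rightarrow> real^'n \<Rightarrow> real" where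
  "nonlocal_op K u x = Lim (at_right 0) (truncated_integral K u x)"

text \<open>
  \<open>Lim\<close> and the Bochner integral are total functions. The next predicate says that all the truncated
  integrals converge absolutely and that the limit defining \<open>nonlocal_op K u x\<close> exists as a real number.
\<close>

definition nonlocal_op_exists ::
  "(real^'n \<Rightarrow> real^'n \<Rightarrow> real) \<Rightarrow> (real^'n \<Rightarrow> real) \<Rightarrow> real^'n \<Rightarrow> bool" where
  "nonlocal_op_exists K u x \<longleftrightarrow>
     (\<forall>\<epsilon>>0. set_integrable lebesgue (- ball x \<epsilon>) (\<lambda>y. (u x - u y) * K x y)) \<and>
     (\<exists>L. (truncated_integral K u x \<longlongrightarrow> L) (at_right 0))"

definition kernel_class_nonneg :: "real \<Rightarrow> (real^'n \<Rightarrow> real^'n \<Rightarrow> real) set" where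
  "kernel_class_nonneg \<theta> = {K.
     (\<lambda>(x, y). K x y) \<in> borel_measurable lebesgue \<and>
     (\<forall>y \<in> - ball 0 3. continuous_on (ball 0 1) (\<lambda>x. K x y)) \<and>
     (\<forall>x \<in> ball 0 1.
        finite_lebesgue_integral UNIV (\<lambda>y. ennreal (min (norm (x - y) powr \<theta>) 1 * \<bar>K x y\<bar>))) \<and>
     (\<forall>x \<in> ball 0 1. \<forall>z \<in> ball 0 1. K x (x + z) = K x (x - z)) \<and>
     (\<forall>x \<in> ball 0 1. \<forall>y. K x y \<ge> 0)}"

definition locally_integrable :: "(real^'n \<Rightarrow> real) \<Rightarrow> bool" where
  "locally_integrable u \<longleftrightarrow>
     u \<in> borel_measurable lebesgue \<and> (\<forall>C. compact C \<longrightarrow> set_integrable lebesgue C u)"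

definition admissible_functions ::
  "(real^'n \<Rightarrow> real^'n \<Rightarrow> real) \<Rightarrow> (real^'n \<Rightarrow> real) set" where
  "admissible_functions K = {u.
     locally_integrable u \<and>
     continuous_on (ball 0 4) u \<and>
     (\<exists>C. AE y in lebesgue. y \<in> ball 0 4 \<longrightarrow> \<bar>u y\<bar> \<le> C) \<and>
     finite_lebesgue_integral (- ball 0 3)
       (\<lambda>y. ennreal \<bar>u y\<bar> * (SUP x \<in> ball 0 1. ennreal \<bar>K x y\<bar>))}"

text \<open>
  Twice continuously differentiable up to the boundary: \<open>G\<close> is the gradient and \<open>H\<close> the Hessian, as
  derivatives within \<open>S\<close>. The definition is used for closed balls of positive radius, where these
  derivatives are unique.
\<close>

definition C2_on :: "(real^'n) set \<Rightarrow> (real^'n \<Rightarrow> real) \<Rightarrow> bool" where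
  "C2_on S \<phi> \<longleftrightarrow>
     (\<exists>(G :: real^'n \<Rightarrow> real^'n) (H :: real^'n \<Rightarrow> (real^'n) \<Rightarrow>\<^sub>L (real^'n)).
        (\<forall>x\<in>S. (\<phi> has_derivative (\<lambda>h. G x \<bullet> h)) (at x within S)) \<and>
        (\<forall>x\<in>S. (G has_derivative blinfun_apply (H x)) (at x within S)) \<and>
        continuous_on S H)"

definition viscosity_solution ::
  "(real^'n \<Rightarrow> real^'n \<Rightarrow> real) \<Rightarrow> (real^'n \<Rightarrow> real) \<Rightarrow> (real^'n \<Rightarrow> real) \<Rightarrow> bool" where
  "viscosity_solution K v g \<longleftrightarrow>
     (\<forall>x\<^sub>0 \<rho> \<phi>.
        x\<^sub>0 \<in> ball 0 1 \<and> \<rho> > 0 \<and> cball x\<^sub>0 \<rho> \<subseteq> ball 0 1 \<and>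
        C2_on (cball x\<^sub>0 \<rho>) \<phi> \<and>
        (\<forall>y. y \<notin> ball x\<^sub>0 \<rho> \<longrightarrow> \<phi> y = v y) \<and> \<phi> x\<^sub>0 = v x\<^sub>0 \<longrightarrow>
        ((\<forall>y \<in> ball x\<^sub>0 \<rho>. \<phi> y \<le> v y) \<longrightarrow>
           nonlocal_op_exists K \<phi> x\<^sub>0 \<and> nonlocal_op K \<phi> x\<^sub>0 \<ge> g x\<^sub>0) \<and>
        ((\<forall>y \<in> ball x\<^sub>0 \<rho>. \<phi> y \<ge> v y) \<longrightarrow>
           nonlocal_op_exists K \<phi> x\<^sub>0 \<and> nonlocal_op K \<phi> x\<^sub>0 \<le> g x\<^sub>0))"

text \<open>
  The case \<open>m = 0\<close> of the definition up to polynomials of degree at most \<open>m - 1\<close>, where the only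
  such polynomial is zero.
\<close>

definition viscosity_solution_mod0 ::
  "(real^'n \<Rightarrow> real^'n \<Rightarrow> real) \<Rightarrow> (real^'n \<Rightarrow> real) \<Rightarrow> (real^'n \<Rightarrow> real) \<Rightarrow> bool" where
  "viscosity_solution_mod0 K u f \<longleftrightarrow>
     (\<exists>F :: real \<Rightarrow> real^'n \<Rightarrow> real.
        (\<forall>R>3. continuous_on (ball 0 1) (F R) \<and> bounded (F R ` ball 0 1) \<and>
               viscosity_solution K (\<lambda>y. indicator (ball 0 R) y * u y) (F R)) \<and>
        uniform_limit (ball 0 1) F f at_top)"

end

theory Submission imports Defs begin

text \<open>
  Adding to \<open>v\<close> a function \<open>w\<close> that vanishes in the unit ball changes every truncated integral at
  \<open>x\<close> by the same number \<open>- \<integral> w K(x, \<cdot>)\<close>, and it carries test functions for \<open>v\<close> to test functions for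
  \<open>v + w\<close>. Hence a cut-off of \<open>u\<close> outside \<open>B\<^sub>R\<close> only shifts the right-hand side by the tail
  \<open>\<integral>\<^bsub>|y| \<ge> R\<^esub> u K(x, \<cdot>)\<close>, which by dominated convergence is continuous in \<open>x\<close> and tends to zero
  uniformly.
\<close>

section \<open>Perturbing the solution away from the unit ball, and limits of right-hand
  sides\<close>

lemma C2_on_cong:
  fixes \<phi> \<psi> :: "real^'n \<Rightarrow> real"
  assumes "C2_on S \<phi>" and eq: "\<And>x. x \<in> S \<Longrightarrow> \<psi> x = \<phi> x"
  shows "C2_on S \<psi>"
proof -
  obtain G and H :: "real^'n \<Rightarrow> (real^'n) \<Rightarrow>\<^sub>L (real^'n)" where
    G: "\<forall>x\<in>S. (\<phi> has_derivative (\<lambda>h. G x \<bullet> h)) (at x within S)" and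
    H: "\<forall>x\<in>S. (G has_derivative blinfun_apply (H x)) (at x within S)" "continuous_on S H"
    using assms(1) unfolding C2_on_def by blast
  have "\<forall>x\<in>S. (\<psi> has_derivative (\<lambda>h. G x \<bullet> h)) (at x within S)"
    using G eq has_derivative_transform by blast
  with H show ?thesis
    unfolding C2_on_def by blast
qed

text \<open>Near \<open>x\<close> the function \<open>w\<close> is zero, so the singularity of the
  kernel at \<open>x\<close> never meets it and \<open>w * K x\<close> has an ordinary integral.
  Integrability is carried over for every radius, as \<open>nonlocal_op_exists\<close> demands,
  while the integrals are compared only for small radii, which determine the limit.\<close>

lemma nonlocal_op_add:
  fixes K :: "real^'n \<Rightarrow> real^'n \<Rightarrow> real"
  assumes ex: "nonlocal_op_exists K \<phi> x"
    and d: "d > 0" "\<And>y. y \<in> ball x d \<Longrightarrow> w y = 0"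
    and w: "integrable lebesgue (\<lambda>y. w y * K x y)"
  shows "nonlocal_op_exists K (\<lambda>y. \<phi> y + w y) x"
    and "nonlocal_op K (\<lambda>y. \<phi> y + w y) x = nonlocal_op K \<phi> x - (LINT y|lebesgue. w y * K x y)"
proof -
  let ?\<psi> = "\<lambda>y. \<phi> y + w y" and ?I = "LINT y|lebesgue. w y * K x y"
  have wx: "w x = 0"
    using d by simp
  have eq: "(?\<psi> x - ?\<psi> y) * K x y = (\<phi> x - \<phi> y) * K x y - w y * K x y" for y
    by (simp add: wx algebra_simps)
  have int\<phi>: "set_integrable lebesgue (- ball x \<epsilon>) (\<lambda>y. (\<phi> x - \<phi> y) * K x y)" if "\<epsilon> > 0" for \<epsilon>
    using ex that unfolding nonlocal_op_exists_def by blast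
  have intw: "set_integrable lebesgue (- ball x \<epsilon>) (\<lambda>y. w y * K x y)" for \<epsilon>
    using w unfolding set_integrable_def
    by (intro integrable_mult_indicator) auto
  have int\<psi>: "set_integrable lebesgue (- ball x \<epsilon>) (\<lambda>y. (?\<psi> x - ?\<psi> y) * K x y)" if "\<epsilon> > 0" for \<epsilon>
    unfolding eq by (intro set_integral_diff int\<phi> intw that)
  have trunc: "truncated_integral K ?\<psi> x \<epsilon> = truncated_integral K \<phi> x \<epsilon> - ?I"
    if "\<epsilon> > 0" "\<epsilon> < d" for \<epsilon>
  proof -
    \<comment> \<open>For \<open>\<epsilon> < d\<close> the excised ball lies in the zero set of
      \<open>w\<close>, so removing it costs nothing and the value is independent of
      \<open>\<epsilon>\<close>.\<close>
    have "(LINT y:- ball x \<epsilon>|lebesgue. w y * K x y) = ?I"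
      unfolding set_lebesgue_integral_def
      by (intro Bochner_Integration.integral_cong) (use d that in \<open>auto simp: indicator_def\<close>)
    then show ?thesis
      unfolding truncated_integral_def eq
      using set_integral_diff(2)[OF int\<phi> intw] that by simp
  qed
  have ev: "eventually (\<lambda>\<epsilon>. truncated_integral K \<phi> x \<epsilon> - ?I = truncated_integral K ?\<psi> x \<epsilon>) (at_right 0)"
    unfolding eventually_at_right_field using d(1) trunc by force
  obtain L where L: "(truncated_integral K \<phi> x \<longlongrightarrow> L) (at_right 0)"
    using ex unfolding nonlocal_op_exists_def by blast
  then have L': "(truncated_integral K ?\<psi> x \<longlongrightarrow> L - ?I) (at_right 0)"
    using ev by (intro Lim_transform_eventually[OF tendsto_diff[OF L tendsto_const]])
  show "nonlocal_op_exists K ?\<psi> x"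
    using int\<psi> L' unfolding nonlocal_op_exists_def by blast
  show "nonlocal_op K ?\<psi> x = nonlocal_op K \<phi> x - ?I"
    unfolding nonlocal_op_def using L L' by (simp add: tendsto_Lim)
qed

text \<open>Subtracting \<open>w\<close> turns a test function for \<open>v + w\<close> into one for
  \<open>v\<close>: in the test ball nothing changes, and outside it the prescribed values match. As
  \<open>w\<close> may have any sign, the same lemma serves to cut off \<open>u\<close> and to
  restore it.\<close>

lemma viscosity_solution_add:
  fixes K :: "real^'n \<Rightarrow> real^'n \<Rightarrow> real"
  assumes v: "viscosity_solution K v g"
    and w0: "\<And>y. y \<in> ball 0 1 \<Longrightarrow> w y = 0"
    and w: "\<And>x. x \<in> ball 0 1 \<Longrightarrow> integrable lebesgue (\<lambda>y. w y * K x y)"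
  shows "viscosity_solution K (\<lambda>y. v y + w y) (\<lambda>x. g x - (LINT y|lebesgue. w y * K x y))"
proof -
  let ?v = "\<lambda>y. v y + w y" and ?I = "\<lambda>x. LINT y|lebesgue. w y * K x y"
  have "((\<forall>y \<in> ball x \<rho>. \<psi> y \<le> ?v y) \<longrightarrow>
           nonlocal_op_exists K \<psi> x \<and> nonlocal_op K \<psi> x \<ge> g x - ?I x) \<and>
        ((\<forall>y \<in> ball x \<rho>. \<psi> y \<ge> ?v y) \<longrightarrow>
           nonlocal_op_exists K \<psi> x \<and> nonlocal_op K \<psi> x \<le> g x - ?I x)"
    if x: "x \<in> ball 0 1" and \<rho>: "\<rho> > 0" "cball x \<rho> \<subseteq> ball 0 1" and C2: "C2_on (cball x \<rho>) \<psi>"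
      and out: "\<And>y. y \<notin> ball x \<rho> \<Longrightarrow> \<psi> y = ?v y" and at: "\<psi> x = ?v x" for x \<rho> \<psi>
  proof -
    let ?\<phi> = "\<lambda>y. \<psi> y - w y"
    \<comment> \<open>The closed ball is used because \<open>C2_on\<close> concerns derivatives up
      to the boundary.\<close>
    have w\<rho>: "w y = 0" if "y \<in> cball x \<rho>" for y
      using w0 \<rho>(2) that by blast
    have C2': "C2_on (cball x \<rho>) ?\<phi>"
      by (rule C2_on_cong[OF C2]) (simp add: w\<rho>)
    have shift: "nonlocal_op_exists K \<psi> x \<and> nonlocal_op K \<psi> x = nonlocal_op K ?\<phi> x - ?I x"
      if "nonlocal_op_exists K ?\<phi> x"
      using nonlocal_op_add[OF that \<rho>(1) w\<rho> w[OF x]] by simp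
    have "x \<in> ball 0 1 \<and> \<rho> > 0 \<and> cball x \<rho> \<subseteq> ball 0 1 \<and> C2_on (cball x \<rho>) ?\<phi> \<and>
        (\<forall>y. y \<notin> ball x \<rho> \<longrightarrow> ?\<phi> y = v y) \<and> ?\<phi> x = v x"
      using x \<rho> C2' out at by simp
    then have sub: "(\<forall>y \<in> ball x \<rho>. ?\<phi> y \<le> v y) \<longrightarrow>
           nonlocal_op_exists K ?\<phi> x \<and> nonlocal_op K ?\<phi> x \<ge> g x"
      and super: "(\<forall>y \<in> ball x \<rho>. ?\<phi> y \<ge> v y) \<longrightarrow>
           nonlocal_op_exists K ?\<phi> x \<and> nonlocal_op K ?\<phi> x \<le> g x"
      using v[unfolded viscosity_solution_def, rule_format, of x \<rho> ?\<phi>] by blast+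
    show ?thesis
      using sub super shift by (simp add: diff_le_eq le_diff_eq)
  qed
  then show ?thesis
    unfolding viscosity_solution_def by blast
qed

text \<open>The solution \<open>u\<close>, hence also the set of test functions, is the same for all
  \<open>R\<close>. For each test function the operator value is thus a fixed number, and only the
  bound \<open>g R x\<close> moves, so pointwise convergence is enough.\<close>

lemma viscosity_solution_limit:
  assumes sol: "eventually (\<lambda>R. viscosity_solution K u (g R)) F" and "F \<noteq> bot"
    and lim: "\<And>x. x \<in> ball 0 1 \<Longrightarrow> ((\<lambda>R. g R x) \<longlongrightarrow> f x) F"
  shows "viscosity_solution K u f"
  unfolding viscosity_solution_def
proof (intro allI impI, elim conjE, intro conjI impI)
  fix x \<rho> \<phi>
  assume x: "x \<in> ball 0 1" and \<phi>: "0 < \<rho>" "cball x \<rho> \<subseteq> ball 0 1" "C2_on (cball x \<rho>) \<phi>"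
    "\<forall>y. y \<notin> ball x \<rho> \<longrightarrow> \<phi> y = u y" "\<phi> x = u x"
  {
    assume "\<forall>y\<in>ball x \<rho>. \<phi> y \<le> u y"
    with x \<phi> have "viscosity_solution K u h \<Longrightarrow> nonlocal_op_exists K \<phi> x \<and> h x \<le> nonlocal_op K \<phi> x" for h
      unfolding viscosity_solution_def by blast
    then have ev: "eventually (\<lambda>R. nonlocal_op_exists K \<phi> x \<and> g R x \<le> nonlocal_op K \<phi> x) F"
      using sol by (auto elim: eventually_mono)
    \<comment> \<open>Existence does not depend on \<open>R\<close>, so one index from the
      nontrivial filter supplies it.\<close>
    then show "nonlocal_op_exists K \<phi> x"
      using \<open>F \<noteq> bot\<close> by (auto dest: eventually_happens')
    show "f x \<le> nonlocal_op K \<phi> x"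
      using ev by (intro tendsto_upperbound[OF lim[OF x] _ \<open>F \<noteq> bot\<close>]) (auto elim: eventually_mono)
  }
  {
    assume "\<forall>y\<in>ball x \<rho>. u y \<le> \<phi> y"
    with x \<phi> have "viscosity_solution K u h \<Longrightarrow> nonlocal_op_exists K \<phi> x \<and> nonlocal_op K \<phi> x \<le> h x" for h
      unfolding viscosity_solution_def by blast
    then have ev: "eventually (\<lambda>R. nonlocal_op_exists K \<phi> x \<and> nonlocal_op K \<phi> x \<le> g R x) F"
      using sol by (auto elim: eventually_mono)
    then show "nonlocal_op_exists K \<phi> x"
      using \<open>F \<noteq> bot\<close> by (auto dest: eventually_happens')
    show "nonlocal_op K \<phi> x \<le> f x"
      using ev by (intro tendsto_lowerbound[OF lim[OF x] _ \<open>F \<noteq> bot\<close>]) (auto elim: eventually_mono)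
  }
qed

section \<open>Estimates for the tail of \<open>u\<close> against the kernel\<close>

text \<open>Joint Lebesgue measurability does not make every section measurable. The weighted
  section is measurable as part of the finiteness condition, and dividing by the weight recovers
  \<open>K x\<close> off a single point; nonnegativity removes the absolute value.\<close>

lemma kernel_section_measurable:
  fixes K :: "real^'n \<Rightarrow> real^'n \<Rightarrow> real"
  assumes K: "K \<in> kernel_class_nonneg \<theta>" and x: "x \<in> ball 0 1"
  shows "K x \<in> borel_measurable lebesgue"
proof -
  let ?m = "\<lambda>y. min (norm (x - y) powr \<theta>) 1"
  have m: "(\<lambda>y. ennreal (?m y * \<bar>K x y\<bar>)) \<in> borel_measurable lebesgue"
    using K x unfolding kernel_class_nonneg_def finite_lebesgue_integral_def by auto
  have K0: "K x y \<ge> 0" for y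
    using K x unfolding kernel_class_nonneg_def by blast
  have meas: "(\<lambda>y. enn2real (ennreal (?m y * \<bar>K x y\<bar>)) / ?m y) \<in> borel_measurable lebesgue"
    by (intro borel_measurable_divide measurable_compose[OF m] measurable_completion) auto
  show ?thesis
  \<comment> \<open>The weight vanishes exactly at \<open>y = x\<close>, also for
    \<open>\<theta> = 0\<close>, since \<open>0 powr 0 = 0\<close> here.\<close>
  proof (rule measurable_discrete_difference[OF meas, where X = "{x}"])
    fix y assume "y \<notin> {x}"
    then have "?m y \<noteq> 0" by (simp add: min_def)
    then show "enn2real (ennreal (?m y * \<bar>K x y\<bar>)) / ?m y = K x y"
      using K0[of y] by simp
  qed auto
qed

text \<open>A real-valued version of the integrand in \<open>admissible_functions\<close>, as needed
  for dominated convergence of Bochner integrals. Since \<open>enn2real\<close> sends infinity to 0,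
  it dominates only where that integrand is finite.\<close>

definition tail_majorant :: "(real^'n \<Rightarrow> real^'n \<Rightarrow> real) \<Rightarrow> (real^'n \<Rightarrow> real) \<Rightarrow> real^'n \<Rightarrow> real" where
  "tail_majorant K u y =
     enn2real (ennreal \<bar>u y\<bar> * (SUP x \<in> ball 0 1. ennreal \<bar>K x y\<bar>) * indicator (- ball 0 3) y)"

text \<open>A finite integral forces the integrand to be finite almost everywhere. The exceptional
  null set depends on neither \<open>x\<close> nor \<open>R\<close>, so both are quantified inside
  \<open>AE\<close>. The indicator stays on the right so that the bound shrinks as \<open>R\<close>
  grows.\<close>

lemma tail_majorant:
  fixes K :: "real^'n \<Rightarrow> real^'n \<Rightarrow> real"
  assumes u: "u \<in> admissible_functions K"
  shows integrable_tail_majorant: "integrable lebesgue (tail_majorant K u)"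
    and AE_le_tail_majorant: "AE y in lebesgue. \<forall>x \<in> ball 0 1. \<forall>R \<ge> 3.
           \<bar>indicator (- ball 0 R) y * u y * K x y\<bar> \<le> indicator (- ball 0 R) y * tail_majorant K u y"
proof -
  let ?g = "\<lambda>y. ennreal \<bar>u y\<bar> * (SUP x \<in> ball 0 1. ennreal \<bar>K x y\<bar>) * indicator (- ball 0 3) y"
  have meas: "?g \<in> borel_measurable lebesgue" and fin: "(\<integral>\<^sup>+y. ?g y \<partial>lebesgue) < \<infinity>"
    using u unfolding admissible_functions_def finite_lebesgue_integral_def by auto
  have AE: "AE y in lebesgue. ?g y \<noteq> \<infinity>"
    using nn_integral_PInf_AE[OF meas] fin by auto
  have "(\<integral>\<^sup>+y. ennreal (enn2real (?g y)) \<partial>lebesgue) = (\<integral>\<^sup>+y. ?g y \<partial>lebesgue)"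
    using AE by (intro nn_integral_cong_AE) (auto simp: less_top)
  with meas fin show "integrable lebesgue (tail_majorant K u)"
    unfolding tail_majorant_def by (intro integrableI_nonneg) auto
  show "AE y in lebesgue. \<forall>x \<in> ball 0 1. \<forall>R \<ge> 3.
           \<bar>indicator (- ball 0 R) y * u y * K x y\<bar> \<le> indicator (- ball 0 R) y * tail_majorant K u y"
    using AE
  proof eventually_elim
    case (elim y)
    show ?case
    proof (intro ballI allI impI)
      fix x :: "real^'n" and R :: real assume x: "x \<in> ball 0 1" and R: "R \<ge> 3"
      show "\<bar>indicator (- ball 0 R) y * u y * K x y\<bar> \<le> indicator (- ball 0 R) y * tail_majorant K u y"
      proof (cases "y \<in> ball 0 R")
        case False
        with R have "y \<notin> ball 0 3" by auto
        then have g: "?g y = ennreal \<bar>u y\<bar> * (SUP x \<in> ball 0 1. ennreal \<bar>K x y\<bar>)" by simp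
        have "ennreal (\<bar>u y\<bar> * \<bar>K x y\<bar>) \<le> ?g y"
          unfolding g using x by (auto simp: ennreal_mult intro!: mult_left_mono SUP_upper)
        then have "\<bar>u y\<bar> * \<bar>K x y\<bar> \<le> tail_majorant K u y"
          unfolding tail_majorant_def using elim
          by (metis enn2real_mono enn2real_ennreal abs_ge_zero mult_nonneg_nonneg less_top infinity_ennreal_def)
        with False show ?thesis by (simp add: abs_mult)
      qed simp
    qed
  qed
qed

lemma integrable_tail:
  fixes K :: "real^'n \<Rightarrow> real^'n \<Rightarrow> real"
  assumes K: "K \<in> kernel_class_nonneg \<theta>" and u: "u \<in> admissible_functions K"
    and x: "x \<in> ball 0 1" and R: "R \<ge> 3"
  shows "integrable lebesgue (\<lambda>y. indicator (- ball 0 R) y * u y * K x y)"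
proof (rule Bochner_Integration.integrable_bound[OF integrable_tail_majorant[OF u]])
  have "u \<in> borel_measurable lebesgue"
    using u unfolding admissible_functions_def locally_integrable_def by blast
  then show "(\<lambda>y. indicator (- ball 0 R) y * u y * K x y) \<in> borel_measurable lebesgue"
    using kernel_section_measurable[OF K x]
    by (intro borel_measurable_times borel_measurable_indicator) auto
  show "AE y in lebesgue. norm (indicator (- ball 0 R) y * u y * K x y) \<le> norm (tail_majorant K u y)"
    using AE_le_tail_majorant[OF u]
  proof eventually_elim
    case (elim y)
    have "\<bar>indicator (- ball 0 R) y * u y * K x y\<bar> \<le> indicator (- ball 0 R) y * tail_majorant K u y"
      using elim x R by blast
    also have "\<dots> \<le> norm (tail_majorant K u y)"
      by (auto simp: indicator_def)
    finally show ?case by simp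
  qed
qed

text \<open>The bound is free of \<open>x\<close>: it yields both the boundedness of the tail and
  its uniform decay.\<close>

lemma tail_abs_le:
  fixes K :: "real^'n \<Rightarrow> real^'n \<Rightarrow> real"
  assumes K: "K \<in> kernel_class_nonneg \<theta>" and u: "u \<in> admissible_functions K"
    and x: "x \<in> ball 0 1" and R: "R \<ge> 3"
  shows "\<bar>LINT y|lebesgue. indicator (- ball 0 R) y * u y * K x y\<bar>
           \<le> (LINT y|lebesgue. indicator (- ball 0 R) y * tail_majorant K u y)"
proof -
  let ?f = "\<lambda>y. indicator (- ball 0 R) y * u y * K x y"
  have "\<bar>LINT y|lebesgue. ?f y\<bar> \<le> (LINT y|lebesgue. \<bar>?f y\<bar>)"
    by (rule integral_abs_bound)
  also have "\<dots> \<le> (LINT y|lebesgue. indicator (- ball 0 R) y * tail_majorant K u y)"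
  proof (rule integral_mono_AE)
    show "integrable lebesgue (\<lambda>y. \<bar>?f y\<bar>)"
      using integrable_tail[OF K u x R] by (rule integrable_abs)
    show "integrable lebesgue (\<lambda>y. indicator (- ball 0 R) y * tail_majorant K u y)"
      using integrable_mult_indicator[OF _ integrable_tail_majorant[OF u], of "- ball 0 R"] by simp
    show "AE y in lebesgue. \<bar>?f y\<bar> \<le> indicator (- ball 0 R) y * tail_majorant K u y"
      using AE_le_tail_majorant[OF u] by eventually_elim (use x R in blast)
  qed
  finally show ?thesis .
qed

text \<open>Dominated convergence along sequences, with \<open>tail_majorant K u\<close> as the
  common bound for all points of the unit ball.\<close>

lemma continuous_on_tail:
  fixes K :: "real^'n \<Rightarrow> real^'n \<Rightarrow> real"
  assumes K: "K \<in> kernel_class_nonneg \<theta>" and u: "u \<in> admissible_functions K" and R: "R \<ge> 3"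
  shows "continuous_on (ball 0 1) (\<lambda>x. LINT y|lebesgue. indicator (- ball 0 R) y * u y * K x y)"
  unfolding continuous_on_sequentially comp_def
proof (intro ballI allI impI, elim conjE)
  fix X :: "nat \<Rightarrow> real^'n" and a
  assume a: "a \<in> ball 0 1" and X: "\<forall>n. X n \<in> ball 0 1" "X \<longlonglongrightarrow> a"
  show "(\<lambda>n. LINT y|lebesgue. indicator (- ball 0 R) y * u y * K (X n) y)
          \<longlonglongrightarrow> (LINT y|lebesgue. indicator (- ball 0 R) y * u y * K a y)"
  proof (rule integral_dominated_convergence[OF _ _ integrable_tail_majorant[OF u]])
    show "(\<lambda>y. indicator (- ball 0 R) y * u y * K a y) \<in> borel_measurable lebesgue"
      using integrable_tail[OF K u a R] by blast
    show "(\<lambda>y. indicator (- ball 0 R) y * u y * K (X n) y) \<in> borel_measurable lebesgue" for n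
      using integrable_tail[OF K u _ R] X(1) by blast
    show "AE y in lebesgue. norm (indicator (- ball 0 R) y * u y * K (X n) y) \<le> tail_majorant K u y" for n
      using AE_le_tail_majorant[OF u]
    proof eventually_elim
      case (elim y)
      have "\<bar>indicator (- ball 0 R) y * u y * K (X n) y\<bar> \<le> indicator (- ball 0 R) y * tail_majorant K u y"
        using elim X(1) R by blast
      also have "\<dots> \<le> tail_majorant K u y"
        by (auto simp: indicator_def tail_majorant_def)
      finally show ?case by simp
    qed
    have "(\<lambda>n. K (X n) y) \<longlonglongrightarrow> K a y" if "y \<notin> ball 0 R" for y
    proof -
      have "y \<in> - ball 0 3" using that R by auto
      then have "continuous_on (ball 0 1) (\<lambda>x. K x y)"
        using K unfolding kernel_class_nonneg_def by blast
      then show ?thesis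
        using X a unfolding continuous_on_sequentially comp_def by blast
    qed
    \<comment> \<open>Inside \<open>ball 0 R\<close> the indicator makes both sides zero; outside
      it, \<open>R \<ge> 3\<close> gives access to the continuity of the kernel in its first
      argument.\<close>
    then have "(\<lambda>n. indicator (- ball 0 R) y * u y * K (X n) y)
        \<longlonglongrightarrow> indicator (- ball 0 R) y * u y * K a y" for y
      by (cases "y \<in> ball 0 R") (auto intro: tendsto_mult)
    then show "AE y in lebesgue. (\<lambda>n. indicator (- ball 0 R) y * u y * K (X n) y)
        \<longlonglongrightarrow> indicator (- ball 0 R) y * u y * K a y"
      by simp
  qed
qed

text \<open>By \<open>tail_abs_le\<close> the tail is at most the integral of one fixed integrable
  function over the complement of \<open>ball 0 R\<close>, and these sets shrink to the empty
  set.\<close>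

lemma uniform_limit_tail:
  fixes K :: "real^'n \<Rightarrow> real^'n \<Rightarrow> real"
  assumes K: "K \<in> kernel_class_nonneg \<theta>" and u: "u \<in> admissible_functions K"
  shows "uniform_limit (ball 0 1) (\<lambda>R x. LINT y|lebesgue. indicator (- ball 0 R) y * u y * K x y)
           (\<lambda>_. 0) at_top"
proof -
  let ?G = "\<lambda>R y. indicator (- ball 0 R) y * tail_majorant K u y"
  have int: "integrable lebesgue (?G R)" for R
    using integrable_mult_indicator[OF _ integrable_tail_majorant[OF u], of "- ball 0 R"] by simp
  have "((\<lambda>R. LINT y|lebesgue. ?G R y) \<longlongrightarrow> (LINT y::real^'n|lebesgue. (0::real))) at_top"
  proof (rule integral_dominated_convergence_at_top[where w = "tail_majorant K u"])
    show "integrable lebesgue (tail_majorant K u)"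
      by (rule integrable_tail_majorant[OF u])
    show "eventually (\<lambda>R. AE y in lebesgue. norm (?G R y) \<le> tail_majorant K u y) at_top"
      by (auto simp: indicator_def tail_majorant_def)
    \<comment> \<open>Once \<open>R\<close> exceeds \<open>norm y\<close>, the point
      \<open>y\<close> lies in the ball and the value is exactly 0.\<close>
    have "((\<lambda>R. ?G R y) \<longlongrightarrow> 0) at_top" for y
      by (rule tendsto_eventually)
        (use eventually_gt_at_top[of "norm y"] in \<open>eventually_elim, simp\<close>)
    then show "AE y in lebesgue. ((\<lambda>R. ?G R y) \<longlongrightarrow> 0) at_top" by simp
  qed (use int in auto)
  then have lim: "((\<lambda>R. LINT y|lebesgue. ?G R y) \<longlongrightarrow> 0) at_top" by simp
  show ?thesis
    unfolding uniform_limit_iff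
  proof (intro allI impI)
    fix e :: real assume "e > 0"
    with lim have "eventually (\<lambda>R. (LINT y|lebesgue. ?G R y) < e) at_top"
      by (simp add: order_tendstoD(2))
    with eventually_ge_at_top[of 3]
    show "eventually (\<lambda>R. \<forall>x\<in>ball 0 1.
        dist (LINT y|lebesgue. indicator (- ball 0 R) y * u y * K x y) 0 < e) at_top"
    proof eventually_elim
      case (elim R)
      then show ?case
        using le_less_trans[OF tail_abs_le[OF K u]] by (simp only: dist_real_def diff_zero) blast
    qed
  qed
qed

section \<open>The equivalence of the two notions of solution\<close>

theorem corollary4p8:
  fixes \<theta> :: real
    and K :: "real^'n \<Rightarrow> real^'n \<Rightarrow> real"
    and u f :: "real^'n \<Rightarrow> real"
  assumes "0 \<le> \<theta>" and "\<theta> \<le> 2"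
    and "K \<in> kernel_class_nonneg \<theta>"
    and "\<forall>y. \<forall>x\<^sub>0 \<in> ball 0 3 - {y}. ((\<lambda>x. K x y) \<longlongrightarrow> K x\<^sub>0 y) (at x\<^sub>0)"
    and "\<forall>x\<^sub>0 \<in> ball 0 3. \<forall>r>0.
           finite_lebesgue_integral (- ball x\<^sub>0 r) (\<lambda>y. SUP x \<in> ball 0 3 - ball y r. ennreal \<bar>K x y\<bar>)"
    and "finite_lebesgue_integral (ball 0 3)
           (\<lambda>y. SUP x \<in> ball 0 1. ennreal ((norm (x - y))\<^sup>2 * \<bar>K x y\<bar>))"
    and "u \<in> admissible_functions K"
    and "continuous_on (ball 0 1) f" and "bounded (f ` ball 0 1)"
  shows "viscosity_solution K u f \<longleftrightarrow> viscosity_solution_mod0 K u f"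
proof -
  note K = assms(3) and u = assms(7)
  define h where "h R x = (LINT y|lebesgue. indicator (- ball 0 R) y * u y * K x y)" for R x
  have int: "integrable lebesgue (\<lambda>y. indicator (- ball 0 R) y * u y * K x y)"
    if "x \<in> ball 0 1" "R > 3" for x R
    using integrable_tail[OF K u] that by simp
  have h_lim: "uniform_limit (ball 0 1) h (\<lambda>_. 0) at_top"
    using uniform_limit_tail[OF K u] unfolding h_def .
  show ?thesis
  proof
    assume sol: "viscosity_solution K u f"
    \<comment> \<open>Cutting off \<open>u\<close> adds minus the tail; as \<open>u y\<close> enters
      the operator with a minus sign, the right-hand side gains \<open>+ h R x\<close>.\<close>
    let ?F = "\<lambda>R x. f x + h R x"
    have "viscosity_solution K (\<lambda>y. indicator (ball 0 R) y * u y) (?F R)" if R: "R > 3" for R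
    proof -
      let ?w = "\<lambda>y. - (indicator (- ball 0 R) y * u y)"
      have "viscosity_solution K (\<lambda>y. u y + ?w y) (\<lambda>x. f x - (LINT y|lebesgue. ?w y * K x y))"
      proof (rule viscosity_solution_add[OF sol])
        show "integrable lebesgue (\<lambda>y. ?w y * K x y)" if "x \<in> ball 0 1" for x
          using integrable_minus[OF int[OF that R]] by simp
      qed (use R in auto)
      moreover have "u y + ?w y = indicator (ball 0 R) y * u y" for y
        by (simp add: indicator_def)
      ultimately show ?thesis
        by (simp add: h_def)
    qed
    moreover have "continuous_on (ball 0 1) (?F R)" if "R > 3" for R
      using continuous_on_tail[OF K u] that assms(8) unfolding h_def by (intro continuous_on_add) auto
    moreover have "bounded (?F R ` ball 0 1)" if "R > 3" for R
    proof (rule bounded_plus_comp[OF assms(9)])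
      show "bounded (h R ` ball 0 1)"
        using tail_abs_le[OF K u _ less_imp_le[OF that]]
        unfolding bounded_iff h_def image_iff real_norm_def by blast
    qed
    moreover have "uniform_limit (ball 0 1) ?F f at_top"
      using uniform_limit_add[OF uniform_limit_const h_lim, of f] by simp
    ultimately show "viscosity_solution_mod0 K u f"
      unfolding viscosity_solution_mod0_def by (intro exI[of _ ?F]) simp
  next
    assume "viscosity_solution_mod0 K u f"
    then obtain F where
      F: "\<And>R. R > 3 \<Longrightarrow> viscosity_solution K (\<lambda>y. indicator (ball 0 R) y * u y) (F R)" and
      F_lim: "uniform_limit (ball 0 1) F f at_top"
      unfolding viscosity_solution_mod0_def by blast
    \<comment> \<open>Restoring the tail undoes the cut-off at each \<open>R\<close>, so the one
      function \<open>u\<close> solves a whole family of equations whose right-hand sides tend to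
      \<open>f\<close>.\<close>
    have "viscosity_solution K u (\<lambda>x. F R x - h R x)" if R: "R > 3" for R
    proof -
      let ?w = "\<lambda>y. indicator (- ball 0 R) y * u y"
      have "viscosity_solution K (\<lambda>y. indicator (ball 0 R) y * u y + ?w y)
          (\<lambda>x. F R x - (LINT y|lebesgue. ?w y * K x y))"
        by (rule viscosity_solution_add[OF F[OF R] _ int[OF _ R]]) (use R in auto)
      moreover have "indicator (ball 0 R) y * u y + ?w y = u y" for y
        by (simp add: indicator_def)
      ultimately show ?thesis
        by (simp add: h_def)
    qed
    then have "eventually (\<lambda>R. viscosity_solution K u (\<lambda>x. F R x - h R x)) at_top"
      using eventually_gt_at_top[of 3] by (rule eventually_mono[rotated])
    then show "viscosity_solution K u f"
    proof (rule viscosity_solution_limit)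
      show "((\<lambda>R. F R x - h R x) \<longlongrightarrow> f x) at_top" if "x \<in> ball 0 1" for x
        using tendsto_diff[OF tendsto_uniform_limitI[OF F_lim that] tendsto_uniform_limitI[OF h_lim that]]
        by simp
    qed simp
  qed
qed

end
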